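(* Let $\mathcal{C}$ be an $\mathbf{Ord}$-category with comma-objects and pullbacks. Suppose that $\varphi\colon\mathsf{S}\to\mathsf{T}$ is a monad morphism between $\mathbf{Ord}$-monads on $\mathcal{C}$ whose components are pullback-stable $\mathsf{T}$-embeddings, and that $\mathsf{T}$-embeddings are full. If $\mathsf{T}$ is lax idempotent, then $\mathsf{S}$ is simple whenever $\mathsf{T}$ is simple.
   Context: $\mathbf{Ord}$ is the category of posets and monotone maps. An $\mathbf{Ord}$-category is a locally small category whose hom-sets are posets and whose composition is monotone in each variable; an $\mathbf{Ord}$-functor is a functor monotone on hom-posets; an $\mathbf{Ord}$-monad is a monad whose functor part is an $\mathbf{Ord}$-functor. It is lax idempotent if $T\eta\le\eta T$. Limits are $\mathbf{Ord}$-enriched. A monad morphism $\varphi\colon\mathsf{S}\to\mathsf{T}$ is a natural transformation $S\Rightarrow T$ compatible with units and multiplications. A morphism $g\colon X\to Y$ of $\mathcal{C}$ is full if for all $Z$ and $u,v\colon Z\to X$, $g\cdot u\le g\cdot v$ implies $u\le v$. A morphism $f\colon X\to Y$ is a $\mathsf{T}$-embedding if there is a morphism of free $\mathsf{T}$-algebras $r\colon TY\to TX$ with $r\cdot Tf=1$ and $Tf\cdot r\le1$ (for $\mathsf{T}$ lax idempotent it is equivalent that $Tf$ have such an $r$ in $\mathcal{C}$). It is a pullback-stable $\mathsf{T}$-embedding if the pullback of $f$ along any morphism into $Y$ is a $\mathsf{T}$-embedding. For an $\mathbf{Ord}$-monad $\mathsf{T}=(T,\eta,\mu)$ and $f\colon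 X\to Y$, let $Kf=Tf\downarrow\eta_Y$ be the comma-object of $Tf\colon TX\to TY$ and $\eta_Y\colon Y\to TY$, with projections $q_f\colon Kf\to TX$, $Rf\colon Kf\to Y$ ($Tf\cdot q_f\le\eta_Y\cdot Rf$), and $Lf\colon X\to Kf$ the unique morphism with $q_f\cdot Lf=\eta_X$, $Rf\cdot Lf=f$. $\mathsf{T}$ is simple if for every $f\colon X\to Y$ in $\mathcal{C}$ the inequality $F^{\mathsf T}(Lf)\cdot\varepsilon_{F^{\mathsf T}X}\cdot F^{\mathsf T}q_f\le 1$ holds in $\mathsf{T}\text{-Alg}$ ($F^{\mathsf T}$ the free algebra functor, $\varepsilon$ the counit of the free algebra adjunction; order on algebra morphisms inherited from $\mathcal{C}$), that is, $T(Lf)\cdot\mu_X\cdot Tq_f\le1_{TKf}$. *)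

theory Defs
  imports Main
begin

section \<open>\<open>Ord\<close>-categories\<close>

text \<open>
  An \<open>Ord\<close>-category has its objects in \<open>'o\<close> and its morphisms in \<open>'m\<close>; every hom-set is
  therefore a set of elements of \<open>'m\<close>. The values of \<open>comp\<close> on non-composable pairs and
  of \<open>le\<close> on non-parallel pairs are never used.
\<close>

record ('o, 'm) ordcat =
  ob :: "'o set"
  arr :: "'m set"
  src :: "'m \<Rightarrow> 'o"
  trg :: "'m \<Rightarrow> 'o"
  ident :: "'o \<Rightarrow> 'm"
  comp :: "'m \<Rightarrow> 'm \<Rightarrow> 'm"  (infixr \<open>\<cdot>\<index>\<close> 70)
  le :: "'m \<Rightarrow> 'm \<Rightarrow> bool"  (infix \<open>\<preceq>\<index>\<close> 50)

definition hom :: "('o, 'm) ordcat \<Rightarrow> 'o \<Rightarrow> 'o \<Rightarrow> 'm set" where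
  "hom C X Y = {f \<in> arr C. src C f = X \<and> trg C f = Y}"

locale ord_category =
  fixes C :: "('o, 'm) ordcat" (structure)
  assumes src_ob: "f \<in> arr C \<Longrightarrow> src C f \<in> ob C"
    and trg_ob: "f \<in> arr C \<Longrightarrow> trg C f \<in> ob C"
    and ident_hom: "X \<in> ob C \<Longrightarrow> ident C X \<in> hom C X X"
    and comp_hom: "\<lbrakk>f \<in> hom C X Y; g \<in> hom C Y Z\<rbrakk> \<Longrightarrow> g \<cdot> f \<in> hom C X Z"
    and comp_ident_right: "f \<in> hom C X Y \<Longrightarrow> f \<cdot> ident C X = f"
    and comp_ident_left: "f \<in> hom C X Y \<Longrightarrow> ident C Y \<cdot> f = f"
    and comp_assoc: "\<lbrakk>f \<in> hom C W X; g \<in> hom C X Y; h \<in> hom C Y Z\<rbrakk>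
      \<Longrightarrow> (h \<cdot> g) \<cdot> f = h \<cdot> (g \<cdot> f)"
    and le_refl: "f \<in> hom C X Y \<Longrightarrow> f \<preceq> f"
    and le_antisym: "\<lbrakk>f \<in> hom C X Y; g \<in> hom C X Y; f \<preceq> g; g \<preceq> f\<rbrakk> \<Longrightarrow> f = g"
    and le_trans: "\<lbrakk>f \<in> hom C X Y; g \<in> hom C X Y; h \<in> hom C X Y; f \<preceq> g; g \<preceq> h\<rbrakk>
      \<Longrightarrow> f \<preceq> h"
    and comp_mono_right: "\<lbrakk>f \<in> hom C X Y; f' \<in> hom C X Y; g \<in> hom C Y Z; f \<preceq> f'\<rbrakk>
      \<Longrightarrow> g \<cdot> f \<preceq> g \<cdot> f'"
    and comp_mono_left: "\<lbrakk>f \<in> hom C X Y; g \<in> hom C Y Z; g' \<in> hom C Y Z; g \<preceq> g'\<rbrakk>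
      \<Longrightarrow> g \<cdot> f \<preceq> g' \<cdot> f"

definition full :: "('o, 'm) ordcat \<Rightarrow> 'm \<Rightarrow> bool" where
  "full C g \<longleftrightarrow> g \<in> arr C \<and>
    (\<forall>Z\<in>ob C. \<forall>u\<in>hom C Z (src C g). \<forall>v\<in>hom C Z (src C g).
       g \<cdot>\<^bsub>C\<^esub> u \<preceq>\<^bsub>C\<^esub> g \<cdot>\<^bsub>C\<^esub> v \<longrightarrow> u \<preceq>\<^bsub>C\<^esub> v)"


section \<open>Comma-objects and pullbacks\<close>

text \<open>
  Limits are \<open>Ord\<close>-enriched: besides the ordinary universal property, the bijection between
  morphisms into the limit and cones is an isomorphism of posets, that is, the projections are
  jointly order-reflecting.
\<close>

definition jointly_full :: "('o, 'm) ordcat \<Rightarrow> 'o \<Rightarrow> 'm \<Rightarrow> 'm \<Rightarrow> bool" where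
  "jointly_full C P p q \<longleftrightarrow>
    (\<forall>W\<in>ob C. \<forall>u\<in>hom C W P. \<forall>v\<in>hom C W P.
       p \<cdot>\<^bsub>C\<^esub> u \<preceq>\<^bsub>C\<^esub> p \<cdot>\<^bsub>C\<^esub> v \<and> q \<cdot>\<^bsub>C\<^esub> u \<preceq>\<^bsub>C\<^esub> q \<cdot>\<^bsub>C\<^esub> v \<longrightarrow> u \<preceq>\<^bsub>C\<^esub> v)"

text \<open>
  \<open>is_comma C f g P p q\<close>: the object \<open>P\<close> with \<open>p : P \<rightarrow> src f\<close> and \<open>q : P \<rightarrow> src g\<close> is a
  comma-object \<open>f \<down> g\<close> of the cospan \<open>f\<close>, \<open>g\<close>, with \<open>f \<cdot> p \<le> g \<cdot> q\<close>.
  \<open>is_pullback\<close> takes its arguments in the same order.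
\<close>

definition is_comma :: "('o, 'm) ordcat \<Rightarrow> 'm \<Rightarrow> 'm \<Rightarrow> 'o \<Rightarrow> 'm \<Rightarrow> 'm \<Rightarrow> bool" where
  "is_comma C f g P p q \<longleftrightarrow>
     f \<in> arr C \<and> g \<in> arr C \<and> trg C f = trg C g \<and>
     P \<in> ob C \<and> p \<in> hom C P (src C f) \<and> q \<in> hom C P (src C g) \<and>
     f \<cdot>\<^bsub>C\<^esub> p \<preceq>\<^bsub>C\<^esub> g \<cdot>\<^bsub>C\<^esub> q \<and>
     (\<forall>W\<in>ob C. \<forall>a\<in>hom C W (src C f). \<forall>b\<in>hom C W (src C g).
        f \<cdot>\<^bsub>C\<^esub> a \<preceq>\<^bsub>C\<^esub> g \<cdot>\<^bsub>C\<^esub> b \<longrightarrow>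
        (\<exists>!h. h \<in> hom C W P \<and> p \<cdot>\<^bsub>C\<^esub> h = a \<and> q \<cdot>\<^bsub>C\<^esub> h = b)) \<and>
     jointly_full C P p q"

definition is_pullback :: "('o, 'm) ordcat \<Rightarrow> 'm \<Rightarrow> 'm \<Rightarrow> 'o \<Rightarrow> 'm \<Rightarrow> 'm \<Rightarrow> bool" where
  "is_pullback C f g P p q \<longleftrightarrow>
     f \<in> arr C \<and> g \<in> arr C \<and> trg C f = trg C g \<and>
     P \<in> ob C \<and> p \<in> hom C P (src C f) \<and> q \<in> hom C P (src C g) \<and>
     f \<cdot>\<^bsub>C\<^esub> p = g \<cdot>\<^bsub>C\<^esub> q \<and>
     (\<forall>W\<in>ob C. \<forall>a\<in>hom C W (src C f). \<forall>b\<in>hom C W (src C g).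
        f \<cdot>\<^bsub>C\<^esub> a = g \<cdot>\<^bsub>C\<^esub> b \<longrightarrow>
        (\<exists>!h. h \<in> hom C W P \<and> p \<cdot>\<^bsub>C\<^esub> h = a \<and> q \<cdot>\<^bsub>C\<^esub> h = b)) \<and>
     jointly_full C P p q"

definition has_comma_objects :: "('o, 'm) ordcat \<Rightarrow> bool" where
  "has_comma_objects C \<longleftrightarrow>
    (\<forall>f\<in>arr C. \<forall>g\<in>arr C. trg C f = trg C g \<longrightarrow> (\<exists>P p q. is_comma C f g P p q))"

definition has_pullbacks :: "('o, 'm) ordcat \<Rightarrow> bool" where
  "has_pullbacks C \<longleftrightarrow>
    (\<forall>f\<in>arr C. \<forall>g\<in>arr C. trg C f = trg C g \<longrightarrow> (\<exists>P p q. is_pullback C f g P p q))"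


section \<open>\<open>Ord\<close>-functors and natural transformations\<close>

record ('o, 'm, 'p, 'n) func =
  fob :: "'o \<Rightarrow> 'p"
  fmor :: "'m \<Rightarrow> 'n"

locale ord_functor = dom_cat: ord_category C + cod_cat: ord_category D
  for C :: "('o, 'm) ordcat" and D :: "('p, 'n) ordcat" +
  fixes F :: "('o, 'm, 'p, 'n, 'z) func_scheme"
  assumes fob_ob: "X \<in> ob C \<Longrightarrow> fob F X \<in> ob D"
    and fmor_hom: "f \<in> hom C X Y \<Longrightarrow> fmor F f \<in> hom D (fob F X) (fob F Y)"
    and fmor_ident: "X \<in> ob C \<Longrightarrow> fmor F (ident C X) = ident D (fob F X)"
    and fmor_comp: "\<lbrakk>f \<in> hom C X Y; g \<in> hom C Y Z\<rbrakk>
      \<Longrightarrow> fmor F (g \<cdot>\<^bsub>C\<^esub> f) = fmor F g \<cdot>\<^bsub>D\<^esub> fmor F f"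
    and fmor_mono: "\<lbrakk>f \<in> hom C X Y; g \<in> hom C X Y; f \<preceq>\<^bsub>C\<^esub> g\<rbrakk>
      \<Longrightarrow> fmor F f \<preceq>\<^bsub>D\<^esub> fmor F g"

definition id_func :: "('o, 'm, 'o, 'm) func" where
  "id_func = \<lparr>fob = (\<lambda>X. X), fmor = (\<lambda>f. f)\<rparr>"

definition comp_func ::
  "('p, 'n, 'q, 'k, 'y) func_scheme \<Rightarrow> ('o, 'm, 'p, 'n, 'z) func_scheme \<Rightarrow> ('o, 'm, 'q, 'k) func"
  where
  "comp_func G F = \<lparr>fob = (\<lambda>X. fob G (fob F X)), fmor = (\<lambda>f. fmor G (fmor F f))\<rparr>"

definition nat_trans ::
  "('o, 'm) ordcat \<Rightarrow> ('p, 'n) ordcat \<Rightarrow> ('o, 'm, 'p, 'n, 'y) func_scheme \<Rightarrow>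
   ('o, 'm, 'p, 'n, 'z) func_scheme \<Rightarrow> ('o \<Rightarrow> 'n) \<Rightarrow> bool" where
  "nat_trans C D F G \<alpha> \<longleftrightarrow>
     (\<forall>X\<in>ob C. \<alpha> X \<in> hom D (fob F X) (fob G X)) \<and>
     (\<forall>X\<in>ob C. \<forall>Y\<in>ob C. \<forall>f\<in>hom C X Y. \<alpha> Y \<cdot>\<^bsub>D\<^esub> fmor F f = fmor G f \<cdot>\<^bsub>D\<^esub> \<alpha> X)"


section \<open>\<open>Ord\<close>-monads\<close>

record ('o, 'm) monad = "('o, 'm, 'o, 'm) func" +
  unit :: "'o \<Rightarrow> 'm"
  mult :: "'o \<Rightarrow> 'm"

locale ord_monad = ord_functor C C T
  for C :: "('o, 'm) ordcat" and T :: "('o, 'm) monad" +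
  assumes unit_nat: "nat_trans C C id_func T (unit T)"
    and mult_nat: "nat_trans C C (comp_func T T) T (mult T)"
    and mult_unit_left: "X \<in> ob C \<Longrightarrow>
      mult T X \<cdot>\<^bsub>C\<^esub> unit T (fob T X) = ident C (fob T X)"
    and mult_unit_right: "X \<in> ob C \<Longrightarrow>
      mult T X \<cdot>\<^bsub>C\<^esub> fmor T (unit T X) = ident C (fob T X)"
    and mult_assoc: "X \<in> ob C \<Longrightarrow>
      mult T X \<cdot>\<^bsub>C\<^esub> mult T (fob T X) = mult T X \<cdot>\<^bsub>C\<^esub> fmor T (mult T X)"

definition lax_idempotent :: "('o, 'm) ordcat \<Rightarrow> ('o, 'm) monad \<Rightarrow> bool" where
  "lax_idempotent C T \<longleftrightarrow> (\<forall>X\<in>ob C. fmor T (unit T X) \<preceq>\<^bsub>C\<^esub> unit T (fob T X))"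

definition monad_morphism ::
  "('o, 'm) ordcat \<Rightarrow> ('o, 'm) monad \<Rightarrow> ('o, 'm) monad \<Rightarrow> ('o \<Rightarrow> 'm) \<Rightarrow> bool" where
  "monad_morphism C S T \<phi> \<longleftrightarrow>
     nat_trans C C S T \<phi> \<and>
     (\<forall>X\<in>ob C. \<phi> X \<cdot>\<^bsub>C\<^esub> unit S X = unit T X) \<and>
     (\<forall>X\<in>ob C. \<phi> X \<cdot>\<^bsub>C\<^esub> mult S X = mult T X \<cdot>\<^bsub>C\<^esub> (fmor T (\<phi> X) \<cdot>\<^bsub>C\<^esub> \<phi> (fob S X)))"

definition alg_hom ::
  "('o, 'm) ordcat \<Rightarrow> ('o, 'm) monad \<Rightarrow> 'o \<times> 'm \<Rightarrow> 'o \<times> 'm \<Rightarrow> 'm set" where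
  "alg_hom C T A B =
     {h \<in> hom C (fst A) (fst B). h \<cdot>\<^bsub>C\<^esub> snd A = snd B \<cdot>\<^bsub>C\<^esub> fmor T h}"

definition free_alg :: "('o, 'm) monad \<Rightarrow> 'o \<Rightarrow> 'o \<times> 'm" where
  "free_alg T X = (fob T X, mult T X)"


section \<open>Embeddings and simple monads\<close>

definition embedding :: "('o, 'm) ordcat \<Rightarrow> ('o, 'm) monad \<Rightarrow> 'm \<Rightarrow> bool" where
  "embedding C T f \<longleftrightarrow> f \<in> arr C \<and>
     (\<exists>r\<in>alg_hom C T (free_alg T (trg C f)) (free_alg T (src C f)).
        r \<cdot>\<^bsub>C\<^esub> fmor T f = ident C (fob T (src C f)) \<and>
        fmor T f \<cdot>\<^bsub>C\<^esub> r \<preceq>\<^bsub>C\<^esub> ident C (fob T (trg C f)))"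

text \<open>
  The pullback of \<open>f\<close> along \<open>g\<close> is the projection \<open>q\<close> to the source of \<open>g\<close>. Embeddings are
  stable under isomorphism, so it does not matter which pullback is taken.
\<close>

definition pullback_stable_embedding :: "('o, 'm) ordcat \<Rightarrow> ('o, 'm) monad \<Rightarrow> 'm \<Rightarrow> bool" where
  "pullback_stable_embedding C T f \<longleftrightarrow> f \<in> arr C \<and>
     (\<forall>g P p q. is_pullback C f g P p q \<longrightarrow> embedding C T q)"

text \<open>
  Here \<open>K\<close>, \<open>q\<close>, \<open>R\<close>, \<open>L\<close> are \<open>Kf\<close>, \<open>q\<^sub>f\<close>, \<open>Rf\<close>, \<open>Lf\<close>; the comma-object determines \<open>L\<close>. The
  composite \<open>T L \<cdot> \<mu>\<^sub>X \<cdot> T q\<close> is the algebra morphism \<open>F\<^sup>T L \<cdot> \<epsilon> \<cdot> F\<^sup>T q\<close>, the counit at the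
  free algebra on \<open>X\<close> being \<open>\<mu>\<^sub>X\<close>, and algebra morphisms are ordered as in \<open>C\<close>. The
  inequality is invariant under isomorphism of comma-objects, so it does not matter which one
  is taken for \<open>Kf\<close>.
\<close>

definition simple :: "('o, 'm) ordcat \<Rightarrow> ('o, 'm) monad \<Rightarrow> bool" where
  "simple C T \<longleftrightarrow>
    (\<forall>X\<in>ob C. \<forall>Y\<in>ob C. \<forall>f\<in>hom C X Y. \<forall>K q R L.
       is_comma C (fmor T f) (unit T Y) K q R \<and>
       L \<in> hom C X K \<and> q \<cdot>\<^bsub>C\<^esub> L = unit T X \<and> R \<cdot>\<^bsub>C\<^esub> L = f \<longrightarrow>
       fmor T L \<cdot>\<^bsub>C\<^esub> (mult T X \<cdot>\<^bsub>C\<^esub> fmor T q) \<preceq>\<^bsub>C\<^esub> ident C (fob T K))"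

end

theory Submission
  imports Defs
begin

text \<open>
  The components of \<open>\<phi>\<close> being full, the comma-object \<open>K\<^sub>S\<close> of \<open>S\<close> is the pullback of \<open>\<phi>\<^sub>X\<close> along
  the projection \<open>q\<^sub>T : K\<^sub>T \<rightarrow> TX\<close> of the comma-object of \<open>T\<close>. Hence the comparison \<open>s : K\<^sub>S \<rightarrow> K\<^sub>T\<close>
  is a \<open>T\<close>-embedding, and \<open>Ts \<cdot> \<phi>\<close> is full. Composing with it turns the inequality for \<open>S\<close> into
  the inequality for \<open>T\<close> restricted along \<open>Ts \<cdot> \<phi>\<close>.
\<close>

section \<open>Full morphisms and embeddings\<close>

context ord_category
begin

lemma hom_ob:
  assumes "f \<in> hom C X Y"
  shows "X \<in> ob C" "Y \<in> ob C"
  using assms src_ob trg_ob by (auto simp: hom_def)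

lemma homD:
  assumes "f \<in> hom C X Y"
  shows "f \<in> arr C" "src C f = X" "trg C f = Y"
  using assms by (auto simp: hom_def)

lemma fullD:
  assumes "full C g" "g \<in> hom C X Y" "u \<in> hom C Z X" "v \<in> hom C Z X" "g \<cdot> u \<preceq> g \<cdot> v"
  shows "u \<preceq> v"
  using assms(1,3-5) hom_ob(1)[OF assms(3)] homD[OF assms(2)] by (auto simp: full_def)

lemma full_comp:
  assumes "full C f" "full C g" and f: "f \<in> hom C X Y" and g: "g \<in> hom C Y Z"
  shows "full C (g \<cdot> f)"
proof -
  have gf: "g \<cdot> f \<in> hom C X Z"
    by (rule comp_hom[OF f g])
  have "u \<preceq> v"
    if u: "u \<in> hom C W X" and v: "v \<in> hom C W X" and le: "(g \<cdot> f) \<cdot> u \<preceq> (g \<cdot> f) \<cdot> v" for W u v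
  proof -
    have "g \<cdot> (f \<cdot> u) \<preceq> g \<cdot> (f \<cdot> v)"
      using le comp_assoc[OF u f g] comp_assoc[OF v f g] by simp
    then have "f \<cdot> u \<preceq> f \<cdot> v"
      using fullD[OF \<open>full C g\<close> g comp_hom[OF u f] comp_hom[OF v f]] by blast
    then show ?thesis
      using fullD[OF \<open>full C f\<close> f u v] by blast
  qed
  then show ?thesis
    using homD[OF gf] by (auto simp: full_def)
qed

text \<open>The retraction cancels \<open>f\<close> while preserving the order. This gives fullness
  of \<open>Ts\<close> for an embedding \<open>s\<close>, whose defining adjoint is such a
  retraction.\<close>

lemma split_mono_full:
  assumes f: "f \<in> hom C X Y" and r: "r \<in> hom C Y X" and rf: "r \<cdot> f = ident C X"
  shows "full C f"
proof -
  have "u \<preceq> v"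
    if u: "u \<in> hom C W X" and v: "v \<in> hom C W X" and le: "f \<cdot> u \<preceq> f \<cdot> v" for W u v
  proof -
    have "r \<cdot> (f \<cdot> u) \<preceq> r \<cdot> (f \<cdot> v)"
      by (rule comp_mono_right[OF comp_hom[OF u f] comp_hom[OF v f] r le])
    then show ?thesis
      using comp_assoc[OF u f r] comp_assoc[OF v f r] rf comp_ident_left[OF u]
        comp_ident_left[OF v] by simp
  qed
  then show ?thesis
    using homD[OF f] by (auto simp: full_def)
qed

text \<open>Presents \<open>f\<close> as a pullback of itself, so that stability under pullback says
  something about \<open>f\<close>.\<close>

lemma pullback_along_ident:
  assumes f: "f \<in> hom C X Y"
  shows "is_pullback C f (ident C Y) X (ident C X) f"
proof -
  note ob = hom_ob[OF f]
  note idX = ident_hom[OF ob(1)] and idY = ident_hom[OF ob(2)]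
  have univ: "\<exists>!h. h \<in> hom C W X \<and> ident C X \<cdot> h = a \<and> f \<cdot> h = b"
    if a: "a \<in> hom C W X" and b: "b \<in> hom C W Y" and eq: "f \<cdot> a = ident C Y \<cdot> b" for W a b
  proof (rule ex1I)
    show "a \<in> hom C W X \<and> ident C X \<cdot> a = a \<and> f \<cdot> a = b"
      using a eq comp_ident_left[OF a] comp_ident_left[OF b] by simp
    show "h = a" if "h \<in> hom C W X \<and> ident C X \<cdot> h = a \<and> f \<cdot> h = b" for h
      using that comp_ident_left[of h] by metis
  qed
  have "jointly_full C X (ident C X) f"
    unfolding jointly_full_def by (metis comp_ident_left)
  then show ?thesis
    unfolding is_pullback_def homD(2,3)[OF f] homD(2,3)[OF idY]
      comp_ident_left[OF f] comp_ident_right[OF f]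
    using f ob idX homD(1)[OF f] homD(1)[OF idY] univ by blast
qed

text \<open>The definition speaks of the pullbacks of \<open>f\<close> only; the one along the
  identity is \<open>f\<close>.\<close>

lemma pullback_stable_embedding_embedding:
  assumes "pullback_stable_embedding C T f"
  shows "embedding C T f"
proof -
  have "f \<in> hom C (src C f) (trg C f)"
    using assms by (auto simp: pullback_stable_embedding_def hom_def)
  then show ?thesis
    using assms pullback_along_ident unfolding pullback_stable_embedding_def by blast
qed

end

section \<open>Comma-objects and the comparison between them\<close>

lemma comma_proj:
  assumes "is_comma C f g P p q" "f \<in> hom C X Z" "g \<in> hom C Y Z"
  shows "p \<in> hom C P X" "q \<in> hom C P Y" "f \<cdot>\<^bsub>C\<^esub> p \<preceq>\<^bsub>C\<^esub> g \<cdot>\<^bsub>C\<^esub> q"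
  using assms by (auto simp: is_comma_def hom_def)

lemma (in ord_category) comma_lift:
  assumes "is_comma C f g P p q" "f \<in> hom C X Z" "g \<in> hom C Y Z"
    and "a \<in> hom C W X" "b \<in> hom C W Y" "f \<cdot> a \<preceq> g \<cdot> b"
  shows "\<exists>h. h \<in> hom C W P \<and> p \<cdot> h = a \<and> q \<cdot> h = b"
  using assms hom_ob(1)[OF assms(4)] homD[OF assms(2)] homD[OF assms(3)]
  unfolding is_comma_def by metis

lemma (in ord_category) comma_jointly_full:
  assumes "is_comma C f g P p q" "u \<in> hom C W P" "v \<in> hom C W P"
    "p \<cdot> u \<preceq> p \<cdot> v" "q \<cdot> u \<preceq> q \<cdot> v"
  shows "u \<preceq> v"
  using assms hom_ob(1)[OF assms(2)] unfolding is_comma_def jointly_full_def by blast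

lemma (in ord_category) comma_eqI:
  assumes c: "is_comma C f g P p q" and u: "u \<in> hom C W P" and v: "v \<in> hom C W P"
    and "p \<cdot> u = p \<cdot> v" "q \<cdot> u = q \<cdot> v"
  shows "u = v"
proof -
  have p: "p \<in> hom C P (src C f)" and q: "q \<in> hom C P (src C g)"
    using c by (auto simp: is_comma_def)
  note refl = le_refl[OF comp_hom[OF u p]] le_refl[OF comp_hom[OF u q]]
  show ?thesis
    using le_antisym[OF u v] comma_jointly_full[OF c u v] comma_jointly_full[OF c v u]
      assms(4,5) refl by simp
qed

text \<open>Fullness of \<open>y\<close> pulls the comma inequality of \<open>M\<close> back to that
  of \<open>K\<close>: a cone \<open>(c, d)\<close> over \<open>x\<close> and \<open>p\<close>
  yields a cone \<open>(c, Q \<cdot> d)\<close> for \<open>K\<close>. The intended instance has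
  \<open>x\<close> and \<open>y\<close> components of \<phi>, \<open>a = Sf\<close>,
  \<open>b = Tf\<close>, and \<open>i\<close>, \<open>j\<close> the units of \<open>S\<close> and
  \<open>T\<close> at \<open>Y\<close>.\<close>

lemma (in ord_category) comma_comparison_pullback:
  assumes cA: "is_comma C a i K q R" and cB: "is_comma C b j M p Q"
    and a: "a \<in> hom C A V" and i: "i \<in> hom C Y V"
    and b: "b \<in> hom C B W" and j: "j \<in> hom C Y W"
    and x: "x \<in> hom C A B" and y: "y \<in> hom C V W" and full_y: "full C y"
    and sq: "b \<cdot> x = y \<cdot> a" and tri: "y \<cdot> i = j"
    and s: "s \<in> hom C K M" and ps: "p \<cdot> s = x \<cdot> q" and Qs: "Q \<cdot> s = R"
  shows "is_pullback C x p K q s"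
proof -
  note q = comma_proj(1)[OF cA a i] and R = comma_proj(2)[OF cA a i]
  note p = comma_proj(1)[OF cB b j] and Q = comma_proj(2)[OF cB b j]
  have lift: "\<exists>h. h \<in> hom C Z K \<and> q \<cdot> h = c \<and> s \<cdot> h = d"
    if c: "c \<in> hom C Z A" and d: "d \<in> hom C Z M" and cd: "x \<cdot> c = p \<cdot> d" for Z c d
  proof -
    have Qd: "Q \<cdot> d \<in> hom C Z Y"
      by (rule comp_hom[OF d Q])
    have l: "y \<cdot> (a \<cdot> c) = (b \<cdot> p) \<cdot> d"
      using comp_assoc[OF c a y] comp_assoc[OF c x b] comp_assoc[OF d p b] sq cd by simp
    have r: "y \<cdot> (i \<cdot> (Q \<cdot> d)) = (j \<cdot> Q) \<cdot> d"
      using comp_assoc[OF Qd i y] comp_assoc[OF d Q j] tri by simp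
    \<comment> \<open>This is the inequality \<open>b \<cdot> p \<preceq> j \<cdot> Q\<close>
      precomposed with \<open>d\<close>.\<close>
    have "y \<cdot> (a \<cdot> c) \<preceq> y \<cdot> (i \<cdot> (Q \<cdot> d))"
      using comp_mono_left[OF d comp_hom[OF p b] comp_hom[OF Q j] comma_proj(3)[OF cB b j]]
      by (simp add: l r)
    then have "a \<cdot> c \<preceq> i \<cdot> (Q \<cdot> d)"
      by (rule fullD[OF full_y y comp_hom[OF c a] comp_hom[OF Qd i]])
    then obtain h where h: "h \<in> hom C Z K" and qh: "q \<cdot> h = c" and Rh: "R \<cdot> h = Q \<cdot> d"
      using comma_lift[OF cA a i c Qd] by blast
    \<comment> \<open>Two morphisms into \<open>M\<close> are compared through its two
      projections.\<close>
    have "p \<cdot> (s \<cdot> h) = p \<cdot> d"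
      using comp_assoc[OF h s p] comp_assoc[OF h q x] ps qh cd by simp
    moreover have "Q \<cdot> (s \<cdot> h) = Q \<cdot> d"
      using comp_assoc[OF h s Q] Qs Rh by simp
    ultimately have "s \<cdot> h = d"
      by (rule comma_eqI[OF cB comp_hom[OF h s] d])
    with h qh show ?thesis by blast
  qed
  have order: "u \<preceq> v"
    if u: "u \<in> hom C Z K" and v: "v \<in> hom C Z K"
      and le: "q \<cdot> u \<preceq> q \<cdot> v" "s \<cdot> u \<preceq> s \<cdot> v" for Z u v
  proof -
    \<comment> \<open>Since \<open>R = Q \<cdot> s\<close>, an inequality after \<open>s\<close>
      gives one after \<open>R\<close>, and \<open>q\<close> and \<open>R\<close> jointly reflect
      the order.\<close>
    have "Q \<cdot> (s \<cdot> u) \<preceq> Q \<cdot> (s \<cdot> v)"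
      by (rule comp_mono_right[OF comp_hom[OF u s] comp_hom[OF v s] Q le(2)])
    then have "R \<cdot> u \<preceq> R \<cdot> v"
      using comp_assoc[OF u s Q] comp_assoc[OF v s Q] Qs by simp
    then show ?thesis
      by (rule comma_jointly_full[OF cA u v le(1)])
  qed
  \<comment> \<open>Uniqueness follows from order reflection, used in both directions.\<close>
  have uniq: "h = k"
    if h: "h \<in> hom C Z K" and k: "k \<in> hom C Z K" and eq: "q \<cdot> h = q \<cdot> k" "s \<cdot> h = s \<cdot> k" for Z h k
    using le_antisym[OF h k] order[OF h k] order[OF k h] eq
      le_refl[OF comp_hom[OF h q]] le_refl[OF comp_hom[OF h s]] by simp
  have univ: "\<exists>!h. h \<in> hom C Z K \<and> q \<cdot> h = c \<and> s \<cdot> h = d"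
    if cd: "c \<in> hom C Z A" "d \<in> hom C Z M" "x \<cdot> c = p \<cdot> d" for Z c d
  proof -
    obtain h where h: "h \<in> hom C Z K" "q \<cdot> h = c" "s \<cdot> h = d"
      using lift[OF cd] by blast
    show ?thesis
    proof (rule ex1I)
      show "h \<in> hom C Z K \<and> q \<cdot> h = c \<and> s \<cdot> h = d"
        using h by simp
      show "k = h" if "k \<in> hom C Z K \<and> q \<cdot> k = c \<and> s \<cdot> k = d" for k
        using that h uniq[of k Z h] by simp
    qed
  qed
  have "jointly_full C K q s"
    unfolding jointly_full_def using order by blast
  then show ?thesis
    unfolding is_pullback_def homD(2,3)[OF x] homD(2,3)[OF p]
    using homD(1)[OF x] homD(1)[OF p] hom_ob(1)[OF s] q s ps univ by simp
qed

section \<open>Transfer of simplicity along \<phi>\<close>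

theorem theorem12p3:
  fixes C :: "('o, 'm) ordcat"
    and S T :: "('o, 'm) monad"
    and \<phi> :: "'o \<Rightarrow> 'm"
  assumes "ord_category C"
    and "has_comma_objects C"
    and "has_pullbacks C"
    and "ord_monad C S"
    and "ord_monad C T"
    and "monad_morphism C S T \<phi>"
    and "\<And>X. X \<in> ob C \<Longrightarrow> pullback_stable_embedding C T (\<phi> X)"
    and "\<And>f. embedding C T f \<Longrightarrow> full C f"
    and "lax_idempotent C T"
    and "simple C T"
  shows "simple C S"
proof -
  interpret ord_category C by fact
  interpret S: ord_monad C S by fact
  interpret T: ord_monad C T by fact
  have \<phi>: "\<phi> X \<in> hom C (fob S X) (fob T X)" if "X \<in> ob C" for X
    using assms(6) that by (simp add: monad_morphism_def nat_trans_def)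
  have \<phi>_nat: "\<phi> Y \<cdot>\<^bsub>C\<^esub> fmor S f = fmor T f \<cdot>\<^bsub>C\<^esub> \<phi> X" if "f \<in> hom C X Y" for X Y f
    using assms(6) that hom_ob[OF that] by (simp add: monad_morphism_def nat_trans_def)
  have \<phi>_unit: "\<phi> X \<cdot>\<^bsub>C\<^esub> unit S X = unit T X" if "X \<in> ob C" for X
    using assms(6) that by (simp add: monad_morphism_def)
  have \<phi>_mult: "\<phi> X \<cdot>\<^bsub>C\<^esub> mult S X = mult T X \<cdot>\<^bsub>C\<^esub> (fmor T (\<phi> X) \<cdot>\<^bsub>C\<^esub> \<phi> (fob S X))"
    if "X \<in> ob C" for X
    using assms(6) that by (simp add: monad_morphism_def)
  have unitS: "unit S X \<in> hom C X (fob S X)" and unitT: "unit T X \<in> hom C X (fob T X)"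
    and multS: "mult S X \<in> hom C (fob S (fob S X)) (fob S X)"
    and multT: "mult T X \<in> hom C (fob T (fob T X)) (fob T X)" if "X \<in> ob C" for X
    using S.unit_nat T.unit_nat S.mult_nat T.mult_nat that
    by (simp_all add: nat_trans_def id_func_def comp_func_def)
  have \<phi>_full: "full C (\<phi> X)" if "X \<in> ob C" for X
    using assms(7)[OF that] assms(8) pullback_stable_embedding_embedding by blast
  show ?thesis
    unfolding simple_def
  proof (intro ballI allI impI, elim conjE)
    fix X Y f K q R L
    assume X: "X \<in> ob C" and Y: "Y \<in> ob C" and f: "f \<in> hom C X Y"
      and cS: "is_comma C (fmor S f) (unit S Y) K q R"
      and L: "L \<in> hom C X K" and qL: "q \<cdot>\<^bsub>C\<^esub> L = unit S X" and RL: "R \<cdot>\<^bsub>C\<^esub> L = f"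
    note Sf = S.fmor_hom[OF f] and Tf = T.fmor_hom[OF f]
    note q = comma_proj(1)[OF cS Sf unitS[OF Y]] and R = comma_proj(2)[OF cS Sf unitS[OF Y]]
    note \<phi>X = \<phi>[OF X] and \<phi>Y = \<phi>[OF Y]
    have K: "K \<in> ob C" using hom_ob L by blast
    have \<phi>q: "\<phi> X \<cdot>\<^bsub>C\<^esub> q \<in> hom C K (fob T X)"
      by (rule comp_hom[OF q \<phi>X])
    obtain M p Q where cT: "is_comma C (fmor T f) (unit T Y) M p Q"
      using assms(2) homD[OF Tf] homD[OF unitT[OF Y]] unfolding has_comma_objects_def by metis
    note p = comma_proj(1)[OF cT Tf unitT[OF Y]] and Q = comma_proj(2)[OF cT Tf unitT[OF Y]]
    \<comment> \<open>Composing the comma inequality of \<open>K\<close> with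
      \<open>\<phi>\<^sub>Y\<close> makes \<open>(\<phi>\<^sub>X \<cdot> q, R)\<close> a cone for
      \<open>M\<close>, which induces the comparison \<open>s\<close>.\<close>
    have "\<phi> Y \<cdot>\<^bsub>C\<^esub> (fmor S f \<cdot>\<^bsub>C\<^esub> q) \<preceq>\<^bsub>C\<^esub> \<phi> Y \<cdot>\<^bsub>C\<^esub> (unit S Y \<cdot>\<^bsub>C\<^esub> R)"
      by (rule comp_mono_right[OF comp_hom[OF q Sf] comp_hom[OF R unitS[OF Y]] \<phi>Y
            comma_proj(3)[OF cS Sf unitS[OF Y]]])
    then have "fmor T f \<cdot>\<^bsub>C\<^esub> (\<phi> X \<cdot>\<^bsub>C\<^esub> q) \<preceq>\<^bsub>C\<^esub> unit T Y \<cdot>\<^bsub>C\<^esub> R"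
      using comp_assoc[OF q Sf \<phi>Y] comp_assoc[OF q \<phi>X Tf] comp_assoc[OF R unitS[OF Y] \<phi>Y]
        \<phi>_nat[OF f] \<phi>_unit[OF Y] by simp
    then obtain s where s: "s \<in> hom C K M" and ps: "p \<cdot>\<^bsub>C\<^esub> s = \<phi> X \<cdot>\<^bsub>C\<^esub> q" and Qs: "Q \<cdot>\<^bsub>C\<^esub> s = R"
      using comma_lift[OF cT Tf unitT[OF Y] \<phi>q R] by blast
    \<comment> \<open>\<open>N\<close> is the morphism \<open>Lf\<close> of \<open>T\<close>: the
      next two equations are its defining ones.\<close>
    define N where "N = s \<cdot>\<^bsub>C\<^esub> L"
    have N: "N \<in> hom C X M"
      unfolding N_def by (rule comp_hom[OF L s])
    have pN: "p \<cdot>\<^bsub>C\<^esub> N = unit T X"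
      using comp_assoc[OF L s p] comp_assoc[OF L q \<phi>X] ps qL \<phi>_unit[OF X] by (simp add: N_def)
    have QN: "Q \<cdot>\<^bsub>C\<^esub> N = f"
      using comp_assoc[OF L s Q] Qs RL by (simp add: N_def)
    have simpleT: "fmor T N \<cdot>\<^bsub>C\<^esub> (mult T X \<cdot>\<^bsub>C\<^esub> fmor T p) \<preceq>\<^bsub>C\<^esub> ident C (fob T M)"
      using assms(10) X Y f cT N pN QN unfolding simple_def by blast

    \<comment> \<open>This exhibits \<open>s\<close> as the pullback of
      \<open>\<phi>\<^sub>X\<close> along \<open>p\<close>, so the stability hypothesis applies to
      it.\<close>
    have "is_pullback C (\<phi> X) p K q s"
      by (rule comma_comparison_pullback[OF cS cT Sf unitS[OF Y] Tf unitT[OF Y] \<phi>X \<phi>Y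
            \<phi>_full[OF Y] \<phi>_nat[OF f, symmetric] \<phi>_unit[OF Y] s ps Qs])
    then have "embedding C T s"
      using assms(7)[OF X] unfolding pullback_stable_embedding_def by blast
    then obtain r where "r \<in> hom C (fob T M) (fob T K)" "r \<cdot>\<^bsub>C\<^esub> fmor T s = ident C (fob T K)"
      using homD[OF s] by (auto simp: embedding_def alg_hom_def free_alg_def)
    note Ts = T.fmor_hom[OF s] and \<phi>K = \<phi>[OF K]
    have Ts_full: "full C (fmor T s)"
      by (rule split_mono_full[OF Ts]) fact+
    \<comment> \<open>The full morphism from \<open>SK\<close> to \<open>TM\<close> after which the
      inequality for \<open>S\<close> will be tested.\<close>
    define e where "e = fmor T s \<cdot>\<^bsub>C\<^esub> \<phi> K"
    have e: "e \<in> hom C (fob S K) (fob T M)"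
      unfolding e_def by (rule comp_hom[OF \<phi>K Ts])
    have e_full: "full C e"
      unfolding e_def by (rule full_comp[OF \<phi>_full[OF K] Ts_full \<phi>K Ts])

    note Sq = S.fmor_hom[OF q] and Tq = T.fmor_hom[OF q] and SL = S.fmor_hom[OF L]
      and TL = T.fmor_hom[OF L] and Tp = T.fmor_hom[OF p] and TN = T.fmor_hom[OF N]
      and T\<phi> = T.fmor_hom[OF \<phi>X] and mS = multS[OF X] and mT = multT[OF X]
      and \<phi>S = \<phi>[OF S.fob_ob[OF X]]
    note mq = comp_hom[OF Sq mS]
    \<comment> \<open>Naturality of \<phi> at \<open>L\<close> moves \<phi> to the right, and
      \<open>Ts \<cdot> TL = TN\<close>.\<close>
    have eL: "e \<cdot>\<^bsub>C\<^esub> fmor S L = fmor T N \<cdot>\<^bsub>C\<^esub> \<phi> X"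
      using comp_assoc[OF SL \<phi>K Ts] comp_assoc[OF \<phi>X TL Ts] \<phi>_nat[OF L]
        T.fmor_comp[OF L s] by (simp add: e_def N_def)
    have T\<phi>q: "fmor T (\<phi> X) \<cdot>\<^bsub>C\<^esub> fmor T q = fmor T p \<cdot>\<^bsub>C\<^esub> fmor T s"
      using T.fmor_comp[OF q \<phi>X] T.fmor_comp[OF s p] ps by simp
    \<comment> \<open>Compatibility of \<phi> with the multiplications, then naturality at
      \<open>q\<close>, then \<open>T\<close> applied to
      \<open>p \<cdot> s = \<phi>\<^sub>X \<cdot> q\<close>.\<close>
    have "\<phi> X \<cdot>\<^bsub>C\<^esub> (mult S X \<cdot>\<^bsub>C\<^esub> fmor S q)
        = (mult T X \<cdot>\<^bsub>C\<^esub> (fmor T (\<phi> X) \<cdot>\<^bsub>C\<^esub> \<phi> (fob S X))) \<cdot>\<^bsub>C\<^esub> fmor S q"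
      using comp_assoc[OF Sq mS \<phi>X] \<phi>_mult[OF X] by simp
    also have "\<dots> = mult T X \<cdot>\<^bsub>C\<^esub> (fmor T (\<phi> X) \<cdot>\<^bsub>C\<^esub> (fmor T q \<cdot>\<^bsub>C\<^esub> \<phi> K))"
      using comp_assoc[OF Sq comp_hom[OF \<phi>S T\<phi>] mT] comp_assoc[OF Sq \<phi>S T\<phi>] \<phi>_nat[OF q] by simp
    also have "\<dots> = (mult T X \<cdot>\<^bsub>C\<^esub> fmor T p) \<cdot>\<^bsub>C\<^esub> e"
      using comp_assoc[OF \<phi>K Tq T\<phi>] comp_assoc[OF \<phi>K Ts Tp] comp_assoc[OF e Tp mT] T\<phi>q
      by (simp add: e_def)
    finally have \<phi>m: "\<phi> X \<cdot>\<^bsub>C\<^esub> (mult S X \<cdot>\<^bsub>C\<^esub> fmor S q) = (mult T X \<cdot>\<^bsub>C\<^esub> fmor T p) \<cdot>\<^bsub>C\<^esub> e" .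
    note mp = comp_hom[OF Tp mT]
    \<comment> \<open>By \<open>eL\<close> and \<open>\<phi>m\<close>, moving \<open>e\<close> to
      the right turns the composite for \<open>S\<close> into the one for \<open>T\<close>, which
      \<open>simpleT\<close> bounds by the identity.\<close>
    have "e \<cdot>\<^bsub>C\<^esub> (fmor S L \<cdot>\<^bsub>C\<^esub> (mult S X \<cdot>\<^bsub>C\<^esub> fmor S q))
        = (fmor T N \<cdot>\<^bsub>C\<^esub> (mult T X \<cdot>\<^bsub>C\<^esub> fmor T p)) \<cdot>\<^bsub>C\<^esub> e"
      using comp_assoc[OF mq SL e] comp_assoc[OF mq \<phi>X TN] comp_assoc[OF e mp TN] eL \<phi>m by simp
    also have "\<dots> \<preceq>\<^bsub>C\<^esub> ident C (fob T M) \<cdot>\<^bsub>C\<^esub> e"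
      using comp_mono_left[OF e comp_hom[OF mp TN] _ simpleT] ident_hom hom_ob(2)[OF e] by blast
    \<comment> \<open>Writing the bound \<open>e\<close> as \<open>e\<close> after an identity lets
      fullness of \<open>e\<close> cancel it on both sides.\<close>
    also have "\<dots> = e \<cdot>\<^bsub>C\<^esub> ident C (fob S K)"
      using comp_ident_left[OF e] comp_ident_right[OF e] by simp
    finally show "fmor S L \<cdot>\<^bsub>C\<^esub> (mult S X \<cdot>\<^bsub>C\<^esub> fmor S q) \<preceq>\<^bsub>C\<^esub> ident C (fob S K)"
      by (rule fullD[OF e_full e comp_hom[OF mq SL] ident_hom[OF S.fob_ob[OF K]]])
  qed
qed

end
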